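(* Let $n\ge 3$ be an integer and let $m\in\mathbb{R}$ satisfy $0<m\le\frac{n-2}{n}$. Let $\eta>0$, $\alpha<0$ and $\beta\le 0$ be real constants. Then there is no solution $v$ on $(0,\infty)$ of the problem $$\frac{n-1}{m}\left((v^m)''+\frac{n-1}{r}(v^m)'\right)+\alpha v+\beta r v'=0,\qquad v>0,\qquad r\in(0,\infty),$$ with $$v'(0)=0,\qquad v(0)=\eta .$$
   Context: Here $v=v(r)$ is a function of one real variable $r\ge 0$ and $'$ denotes $d/dr$. A solution is a positive function, $C^2$ on $(0,\infty)$ and $C^1$ up to $r=0$, satisfying the equation for all $r>0$ together with the conditions at $r=0$. Such $v$ correspond to the radially symmetric solutions $v(x)=v(|x|)$ of $\frac{n-1}{m}\Delta v^m+\alpha v+\beta x\cdot\nabla v=0$, $v>0$, in $\mathbb{R}^n$, with $v(0)=\eta$. *)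

theory Defs
  imports "HOL-Analysis.Analysis"
begin

definition C2_on_pos :: "(real \<Rightarrow> real) \<Rightarrow> bool" where
  "C2_on_pos v \<longleftrightarrow>
     v C1_differentiable_on {0<..} \<and> deriv v C1_differentiable_on {0<..}"

(* The derivative is taken within the half-line, so it is one-sided at 0 and
   the values of v at negative arguments play no role. *)
definition C1_upto_zero :: "(real \<Rightarrow> real) \<Rightarrow> bool" where
  "C1_upto_zero v \<longleftrightarrow>
     (\<exists>v'. (\<forall>r\<ge>0. (v has_real_derivative v' r) (at r within {0..})) \<and>
           continuous_on {0..} v')"

(* Only evaluated at r > 0, where deriv is the genuine two-sided derivative of a
   C^1 (resp. C^2) function; positivity of v makes v^m as smooth as v. *)
definition radial_ode ::
  "nat \<Rightarrow> real \<Rightarrow> real \<Rightarrow> real \<Rightarrow> (real \<Rightarrow> real) \<Rightarrow> real \<Rightarrow> bool" where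
  "radial_ode n m \<alpha> \<beta> v r \<longleftrightarrow>
     (real n - 1) / m *
       (deriv (deriv (\<lambda>s. v s powr m)) r
         + (real n - 1) / r * deriv (\<lambda>s. v s powr m) r)
     + \<alpha> * v r + \<beta> * r * deriv v r = 0"

definition is_radial_solution ::
  "nat \<Rightarrow> real \<Rightarrow> real \<Rightarrow> real \<Rightarrow> real \<Rightarrow> (real \<Rightarrow> real) \<Rightarrow> bool" where
  "is_radial_solution n m \<alpha> \<beta> \<eta> v \<longleftrightarrow>
     C2_on_pos v \<and> C1_upto_zero v \<and>
     (\<forall>r>0. v r > 0 \<and> radial_ode n m \<alpha> \<beta> v r) \<and>
     (v has_real_derivative 0) (at 0 within {0..}) \<and> v 0 = \<eta>"

end

theory Submission
  imports Defs
begin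

text \<open>
  Since \<open>\<alpha> < 0\<close> and \<open>\<beta> \<le> 0\<close>, the equation forces \<open>v' > 0\<close>: at a first zero of \<open>v'\<close> the flux
  \<open>r^(n-1) (v^m)'\<close> would have been increasing from 0 all along. Hence the drift term has a
  sign, and \<open>w = v^m\<close> satisfies \<open>\<Delta>w \<ge> k w^p\<close> with \<open>k > 0\<close> and \<open>p = 1/m > 1\<close>. By Keller and
  Osserman such a positive entire \<open>w\<close> cannot exist: compare it on a large ball with the
  supersolution \<open>A (S - r^2)^(-q)\<close>, \<open>q = 2/(p-1)\<close>, which blows up at the boundary of the ball
  but has value \<open>w(0)/2\<close> at the centre.
\<close>

section \<open>Continuation of positivity and monotonicity of the radial flux\<close>

lemma continuation_pos:
  fixes f :: "real \<Rightarrow> real"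
  assumes "a \<le> b" and cont: "continuous_on {a..b} f" and "f a > 0"
    and step: "\<And>c. a < c \<Longrightarrow> c \<le> b \<Longrightarrow> (\<And>x. a \<le> x \<Longrightarrow> x < c \<Longrightarrow> f x > 0) \<Longrightarrow> f c > 0"
  shows "f b > 0"
proof (rule ccontr)
  assume "\<not> f b > 0"
  \<comment> \<open>The set \<open>Z\<close> is compact and nonempty, so it has a least point
    \<open>c\<close>. Everything before \<open>c\<close> is positive, and \<open>step\<close> then
    makes \<open>f c\<close> positive as well.\<close>
  define Z where "Z = {x \<in> {a..b}. f x \<le> 0}"
  have "closed Z" unfolding Z_def
    by (rule continuous_on_closed_Collect_le[OF cont continuous_on_const closed_atLeastAtMost])
  moreover have "bounded Z" unfolding Z_def by (rule bounded_subset[of "{a..b}"]) auto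
  ultimately have "compact Z" by (simp add: compact_eq_bounded_closed)
  moreover have "Z \<noteq> {}" using \<open>\<not> f b > 0\<close> \<open>a \<le> b\<close> by (auto simp: Z_def)
  ultimately obtain c where c: "c \<in> Z" and cmin: "\<And>x. x \<in> Z \<Longrightarrow> c \<le> x"
    using compact_attains_inf by metis
  have "f c > 0"
  proof (rule step)
    show "a < c" using c \<open>f a > 0\<close> by (cases "a = c") (auto simp: Z_def)
    show "c \<le> b" using c by (simp add: Z_def)
    show "f x > 0" if "a \<le> x" "x < c" for x
      using cmin[of x] c that by (auto simp: Z_def not_le[symmetric])
  qed
  then show False using c by (simp add: Z_def)
qed

text \<open>The bracket times \<open>r ^ N\<close> is the derivative of \<open>r ^ N * g r\<close>,
  so this product increases strictly. It starts from 0 because \<open>N \<ge> 1\<close> makes the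
  weight vanish at the origin, whatever the value \<open>g 0\<close>.\<close>

lemma radial_flux_increasing:
  fixes g g' :: "real \<Rightarrow> real"
  assumes "N \<ge> 1" and "0 < c" and cont: "continuous_on {0..c} g"
    and deriv: "\<And>r. 0 < r \<Longrightarrow> r < c \<Longrightarrow> (g has_real_derivative g' r) (at r)"
    and pos: "\<And>r. 0 < r \<Longrightarrow> r < c \<Longrightarrow> g' r + real N / r * g r > 0"
  shows "g c > 0"
proof -
  have "0 ^ N * g 0 < c ^ N * g c"
  proof (rule DERIV_pos_imp_increasing_open[OF \<open>0 < c\<close>])
    show "\<exists>y. ((\<lambda>r. r ^ N * g r) has_real_derivative y) (at x) \<and> 0 < y" if x: "0 < x" "x < c" for x
    proof (intro exI conjI)
      show "((\<lambda>r. r ^ N * g r) has_real_derivative x ^ N * (g' x + real N / x * g x)) (at x)"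
      proof (rule DERIV_cong[OF DERIV_mult[OF DERIV_pow deriv[OF x]]])
        obtain M where "N = Suc M" using \<open>N \<ge> 1\<close> by (cases N) auto
        then show "real N * x ^ (N - Suc 0) * g x + g' x * x ^ N
            = x ^ N * (g' x + real N / x * g x)"
          using x by (simp add: field_simps)
      qed
      show "0 < x ^ N * (g' x + real N / x * g x)" using pos x by simp
    qed
    show "continuous_on {0..c} (\<lambda>r. r ^ N * g r)" by (intro continuous_intros cont)
  qed
  then show ?thesis using \<open>N \<ge> 1\<close> \<open>0 < c\<close> by (simp add: zero_power zero_less_mult_iff)
qed

section \<open>The blow-up barrier and the Keller-Osserman comparison\<close>

lemma boundary_blowup_derivs:
  fixes A S q r :: real
  assumes "r\<^sup>2 < S"
  shows "((\<lambda>r. A * (S - r\<^sup>2) powr -q) has_real_derivative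
           2 * A * q * r * (S - r\<^sup>2) powr (-q - 1)) (at r)"
    and "((\<lambda>r. 2 * A * q * r * (S - r\<^sup>2) powr (-q - 1)) has_real_derivative
           2 * A * q * (S - r\<^sup>2) powr (-q - 1)
             + 4 * A * q * (q + 1) * r\<^sup>2 * (S - r\<^sup>2) powr (-q - 2)) (at r)"
proof -
  have "r * r < S" using assms by (simp add: power2_eq_square)
  have shift: "-q - 1 - 1 = -q - 2" by simp
  show "((\<lambda>r. A * (S - r\<^sup>2) powr -q) has_real_derivative
           2 * A * q * r * (S - r\<^sup>2) powr (-q - 1)) (at r)"
    using assms by (auto intro!: derivative_eq_intros simp: powr_diff field_simps)
  have "((\<lambda>r. (S - r\<^sup>2) powr (-q - 1)) has_real_derivative
      (-q - 1) * (S - r\<^sup>2) powr (-q - 1 - 1) * (- (2 * r))) (at r)"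
  proof -
    have "((\<lambda>r. S - r\<^sup>2) has_real_derivative - (2 * r)) (at r)"
      by (auto intro!: derivative_eq_intros)
    from DERIV_fun_powr[OF this, of "-q - 1"] show ?thesis using assms by simp
  qed
  note * = DERIV_mult[OF DERIV_cmult[OF DERIV_ident, of "2 * A * q"] this, unfolded shift]
  show "((\<lambda>r. 2 * A * q * r * (S - r\<^sup>2) powr (-q - 1)) has_real_derivative
           2 * A * q * (S - r\<^sup>2) powr (-q - 1)
             + 4 * A * q * (q + 1) * r\<^sup>2 * (S - r\<^sup>2) powr (-q - 2)) (at r)"
    by (rule DERIV_cong[OF *]) (simp add: algebra_simps power2_eq_square)
qed

text \<open>With \<open>q * (p - 1) = 2\<close> the nonlinearity has the same power
  \<open>-q - 2\<close> of \<open>S - r\<^sup>2\<close> as the most singular term of the radial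
  Laplacian, so only coefficients have to be compared. A large enough ball makes this possible for
  any prescribed central value \<open>h\<close>.\<close>

lemma boundary_blowup_supersolution:
  fixes k p h d :: real
  assumes "k > 0" "p > 1" "h > 0" "d \<ge> 0"
  obtains A S q where "A > 0" "S > 0" "q > 0" "A * S powr -q = h"
    and "\<And>r. 0 < r \<Longrightarrow> r\<^sup>2 < S \<Longrightarrow>
      2 * A * q * (S - r\<^sup>2) powr (-q - 1) + 4 * A * q * (q + 1) * r\<^sup>2 * (S - r\<^sup>2) powr (-q - 2)
        + d / r * (2 * A * q * r * (S - r\<^sup>2) powr (-q - 1))
      \<le> k * (A * (S - r\<^sup>2) powr -q) powr p"
proof -
  \<comment> \<open>\<open>C\<close> collects the coefficients of the Laplacian once
    \<open>t\<close> and \<open>r\<^sup>2\<close> are both replaced by \<open>S\<close>;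
    \<open>A\<close> fixes the value at the centre. \<open>S\<close> is then chosen so that
    \<open>k * A powr (p - 1) = C * S\<close>, which closes the estimate.\<close>
  define q where "q = 2 / (p - 1)"
  define C where "C = 2 * q * (d + 1) + 4 * q * (q + 1)"
  define S where "S = C / (k * h powr (p - 1))"
  define A where "A = h * S powr q"
  have q: "q > 0" "q * (p - 1) = 2" using \<open>p > 1\<close> by (simp_all add: q_def divide_eq_eq)
  have "C > 0" unfolding C_def using q \<open>d \<ge> 0\<close> by (intro add_nonneg_pos mult_pos_pos) auto
  then have "S > 0" unfolding S_def using assms by simp
  have "A > 0" unfolding A_def using \<open>S > 0\<close> \<open>h > 0\<close> by simp
  have "k * A powr (p - 1) = k * h powr (p - 1) * S powr (q * (p - 1))"
    unfolding A_def using \<open>h > 0\<close> by (simp add: powr_mult powr_powr)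
  also have "\<dots> = k * h powr (p - 1) * S * S"
    using \<open>S > 0\<close> by (simp add: q(2) power2_eq_square)
  also have "\<dots> = C * S" using assms by (simp add: S_def)
  finally have kA: "k * A powr p = A * C * S"
    using \<open>A > 0\<close> by (simp add: powr_diff field_simps)
  show ?thesis
  proof
    show "A > 0" "S > 0" "q > 0" by fact+
    show "A * S powr -q = h"
      using \<open>S > 0\<close> by (simp add: A_def powr_minus)
    fix r :: real assume r: "0 < r" "r\<^sup>2 < S"
    define t where "t = S - r\<^sup>2"
    define T where "T = t powr (-q - 2)"
    have t: "t > 0" "t \<le> S" using r by (auto simp: t_def)
    have "T \<ge> 0" by (simp add: T_def)
    have t1: "t powr (-q - 1) = t * T"
    proof -
      have "t powr (-q - 1) = t powr (1 + (-q - 2))"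
        by (rule arg_cong[of _ _ "(powr) t"]) simp
      then show ?thesis using t unfolding T_def powr_add by simp
    qed
    have "2 * A * q * (t * T) + 4 * A * q * (q + 1) * r\<^sup>2 * T + d / r * (2 * A * q * r * (t * T))
        = A * T * (2 * q * (d + 1) * t + 4 * q * (q + 1) * r\<^sup>2)"
      using r by (simp add: field_simps)
    \<comment> \<open>Both \<open>t\<close> and \<open>r\<^sup>2\<close> lie between 0 and
      \<open>S\<close>.\<close>
    also have "\<dots> \<le> A * T * (2 * q * (d + 1) * S + 4 * q * (q + 1) * S)"
      using t r q \<open>d \<ge> 0\<close> \<open>A > 0\<close> \<open>T \<ge> 0\<close> by (intro mult_left_mono add_mono) auto
    also have "\<dots> = k * A powr p * T" by (simp add: kA C_def algebra_simps)
    also have "\<dots> = k * (A * t powr -q) powr p"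
    proof -
      have "-q - 2 = -q * p" using q(2) by (simp add: algebra_simps)
      then have "T = (t powr -q) powr p" by (simp add: T_def powr_powr)
      then show ?thesis using \<open>A > 0\<close> by (simp add: powr_mult)
    qed
    finally show "2 * A * q * (S - r\<^sup>2) powr (-q - 1)
        + 4 * A * q * (q + 1) * r\<^sup>2 * (S - r\<^sup>2) powr (-q - 2)
        + d / r * (2 * A * q * r * (S - r\<^sup>2) powr (-q - 1))
      \<le> k * (A * (S - r\<^sup>2) powr -q) powr p"
      by (simp add: t1 t_def[symmetric] T_def[symmetric])
  qed
qed

text \<open>The function \<open>w\<close> would stay above a barrier that tends to infinity at
  radius \<open>sqrt S\<close>, although continuity bounds \<open>w\<close> on the closed interval
  up to that radius.\<close>

lemma keller_osserman_radial:
  fixes w w1 w2 :: "real \<Rightarrow> real"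
  assumes "N \<ge> 1" "k > 0" "p > 1"
    and w0: "w 0 > 0" and w_cont: "continuous_on {0..} w" and w1_cont: "continuous_on {0..} w1"
    and w_deriv: "\<And>r. r > 0 \<Longrightarrow> (w has_real_derivative w1 r) (at r)"
    and w1_deriv: "\<And>r. r > 0 \<Longrightarrow> (w1 has_real_derivative w2 r) (at r)"
    and ineq: "\<And>r. r > 0 \<Longrightarrow> w2 r + real N / r * w1 r \<ge> k * w r powr p"
  shows False
proof -
  obtain A S q where pos: "A > 0" "S > 0" "q > 0" and h: "A * S powr -q = w 0 / 2"
    and super: "\<And>r. 0 < r \<Longrightarrow> r\<^sup>2 < S \<Longrightarrow>
      2 * A * q * (S - r\<^sup>2) powr (-q - 1) + 4 * A * q * (q + 1) * r\<^sup>2 * (S - r\<^sup>2) powr (-q - 2)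
        + real N / r * (2 * A * q * r * (S - r\<^sup>2) powr (-q - 1))
      \<le> k * (A * (S - r\<^sup>2) powr -q) powr p"
    using boundary_blowup_supersolution[of k p "w 0 / 2" "real N"] assms(2,3) w0 by auto
  define f where "f r = A * (S - r\<^sup>2) powr -q" for r
  define f1 where "f1 r = 2 * A * q * r * (S - r\<^sup>2) powr (-q - 1)" for r
  define f2 where "f2 r = 2 * A * q * (S - r\<^sup>2) powr (-q - 1)
    + 4 * A * q * (q + 1) * r\<^sup>2 * (S - r\<^sup>2) powr (-q - 2)" for r
  have f_deriv: "(f has_real_derivative f1 r) (at r)" "(f1 has_real_derivative f2 r) (at r)"
    if "r\<^sup>2 < S" for r
    unfolding f_def[abs_def] f1_def[abs_def] f2_def
    by (rule boundary_blowup_derivs[OF that])+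
  have f_cont: "continuous_on I f" "continuous_on I f1" if "\<And>r. r \<in> I \<Longrightarrow> r\<^sup>2 < S" for I
    using that f_deriv by (blast intro: DERIV_isCont continuous_at_imp_continuous_on)+
  have below: "f b < w b" if "0 \<le> b" "b\<^sup>2 < S" for b
  proof -
    have sub: "r\<^sup>2 < S" if "0 \<le> r" "r \<le> b" for r
      using that power_mono[of r b 2] \<open>b\<^sup>2 < S\<close> by linarith
    have cont: "continuous_on {0..b} (\<lambda>r. w r - f r)" "continuous_on {0..b} (\<lambda>r. w1 r - f1 r)"
      using sub by (auto intro!: continuous_intros f_cont
          intro: continuous_on_subset[OF w_cont] continuous_on_subset[OF w1_cont])
    have "0 < w b - f b"
    proof (rule continuation_pos[OF \<open>0 \<le> b\<close> cont(1)])
      show "0 < w 0 - f 0" using h w0 by (simp add: f_def)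
      fix c assume c: "0 < c" "c \<le> b" and D: "\<And>x. 0 \<le> x \<Longrightarrow> x < c \<Longrightarrow> 0 < w x - f x"
      \<comment> \<open>As long as \<open>w\<close> exceeds \<open>f\<close>, the nonlinear terms
        are ordered the same way, so the flux of the difference is positive. The initial gap
        \<open>w 0 / 2\<close> therefore can only grow.\<close>
      have mono: "w1 r - f1 r > 0" if r: "0 < r" "r < c" for r
      proof (rule radial_flux_increasing[OF \<open>N \<ge> 1\<close> \<open>0 < r\<close>])
        show "continuous_on {0..r} (\<lambda>r. w1 r - f1 r)"
          by (rule continuous_on_subset[OF cont(2)]) (use r c in auto)
        fix x assume x: "0 < x" "x < r"
        have "x\<^sup>2 < S" using sub x r c by simp
        then show "((\<lambda>r. w1 r - f1 r) has_real_derivative w2 x - f2 x) (at x)"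
          using x by (intro DERIV_diff w1_deriv f_deriv)
        \<comment> \<open>Monotonicity of \<open>powr p\<close> needs a nonnegative base; the
          barrier supplies it, since \<open>0 \<le> f x < w x\<close>.\<close>
        have "f x \<ge> 0" using pos by (simp add: f_def)
        moreover have "f x < w x" using D[of x] x r by simp
        ultimately have "k * f x powr p < k * w x powr p"
          using \<open>k > 0\<close> \<open>p > 1\<close> by (simp add: powr_less_mono2)
        then have "f2 x + real N / x * f1 x < w2 x + real N / x * w1 x"
          using super[OF \<open>0 < x\<close> \<open>x\<^sup>2 < S\<close>] ineq[OF \<open>0 < x\<close>]
          unfolding f_def[symmetric] f1_def[symmetric] f2_def[symmetric] by linarith
        then show "w2 x - f2 x + real N / x * (w1 x - f1 x) > 0"
          by (simp add: right_diff_distrib)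
      qed
      have "w 0 - f 0 < w c - f c"
      proof (rule DERIV_pos_imp_increasing_open[OF \<open>0 < c\<close>])
        show "\<exists>y. ((\<lambda>r. w r - f r) has_real_derivative y) (at x) \<and> 0 < y"
          if "0 < x" "x < c" for x
          using that c sub by (intro exI[of _ "w1 x - f1 x"] conjI DERIV_diff w_deriv f_deriv mono) auto
        show "continuous_on {0..c} (\<lambda>r. w r - f r)"
          by (rule continuous_on_subset[OF cont(1)]) (use c in auto)
      qed
      then show "0 < w c - f c" using \<open>0 < w 0 - f 0\<close> by linarith
    qed
    then show ?thesis by simp
  qed
  obtain M where M: "\<And>r. 0 \<le> r \<Longrightarrow> r \<le> sqrt S \<Longrightarrow> w r \<le> M"
  proof -
    have "\<exists>x\<in>{0..sqrt S}. \<forall>r\<in>{0..sqrt S}. w r \<le> w x"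
      by (rule continuous_attains_sup)
        (use pos in \<open>auto intro: continuous_on_subset[OF w_cont]\<close>)
    then show ?thesis using that by (metis atLeastAtMost_iff)
  qed
  have "w 0 \<le> M" using M[of 0] pos by simp
  then have "M > 0" using w0 by linarith
  \<comment> \<open>This \<open>e\<close> solves \<open>A * e powr -q = M\<close>, so the barrier
    reaches the bound \<open>M\<close> at radius \<open>sqrt (S - e)\<close>. The radius is genuine
    because the central value \<open>w 0 / 2\<close> is below \<open>M\<close>, which forces
    \<open>e < S\<close>.\<close>
  define e where "e = (A / M) powr (1 / q)"
  have "e > 0" using pos \<open>M > 0\<close> by (simp add: e_def)
  have fe: "A * e powr -q = M"
    using pos \<open>M > 0\<close> by (simp add: e_def powr_powr powr_minus_divide)
  have "e < S"
  proof (rule ccontr)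
    assume "\<not> e < S"
    then have "e powr -q \<le> S powr -q" using pos by (intro powr_mono2') auto
    then have "M \<le> w 0 / 2" using fe h pos by (metis mult_left_mono less_imp_le)
    then show False using \<open>w 0 \<le> M\<close> w0 by linarith
  qed
  have "f (sqrt (S - e)) < w (sqrt (S - e))"
    by (rule below) (use \<open>e > 0\<close> \<open>e < S\<close> in auto)
  moreover have "f (sqrt (S - e)) = M" using \<open>e < S\<close> fe by (simp add: f_def)
  ultimately show False using M[of "sqrt (S - e)"] \<open>e > 0\<close> \<open>e < S\<close> by simp
qed

section \<open>Reduction of the radial equation to the Keller-Osserman inequality\<close>

theorem theorem1p1:
  fixes n :: nat and m \<alpha> \<beta> \<eta> :: real
  assumes "n \<ge> 3"
    and "0 < m" and "m \<le> (real n - 2) / real n"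
    and "\<eta> > 0" and "\<alpha> < 0" and "\<beta> \<le> 0"
  shows "\<not> (\<exists>v. is_radial_solution n m \<alpha> \<beta> \<eta> v)"
proof
  assume "\<exists>v. is_radial_solution n m \<alpha> \<beta> \<eta> v"
  then obtain v where C2: "C2_on_pos v" and C1: "C1_upto_zero v"
    and vpos': "\<And>r. r > 0 \<Longrightarrow> v r > 0" and ode: "\<And>r. r > 0 \<Longrightarrow> radial_ode n m \<alpha> \<beta> v r"
    and v0: "(v has_real_derivative 0) (at 0 within {0..})" "v 0 = \<eta>"
    unfolding is_radial_solution_def by blast
  \<comment> \<open>The upper bound on \<open>m\<close> enters in this form: it makes the exponent
    \<open>1 / m\<close> superlinear.\<close>
  have "m < 1" 
  proof -
    have "(real n - 2) / real n < 1" using assms(1) by simp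
    then show ?thesis using assms(3) by linarith
  qed
  have vpos: "v r > 0" if "r \<ge> 0" for r
    using vpos'[of r] v0(2) \<open>\<eta> > 0\<close> that by (cases "r = 0") auto
  obtain v1 where v1: "\<And>r. r \<ge> 0 \<Longrightarrow> (v has_real_derivative v1 r) (at r within {0..})"
    and v1_cont: "continuous_on {0..} v1"
    using C1 unfolding C1_upto_zero_def by blast
  have v1_at: "(v has_real_derivative v1 r) (at r)" if "r > 0" for r
  proof -
    have "(v has_real_derivative v1 r) (at r within {0<..})"
      by (rule DERIV_subset[OF v1]) (use that in auto)
    then show ?thesis using that at_within_open[of r "{0<..}"] by simp
  qed
  have dv: "deriv v r = v1 r" if "r > 0" for r using v1_at[OF that] by (rule DERIV_imp_deriv)
  have v1_0: "v1 0 = 0"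
  proof (rule tendsto_unique)
    show "((\<lambda>y. (v y - v 0) / (y - 0)) \<longlongrightarrow> v1 0) (at 0 within {0..})"
      using v1[of 0] by (simp add: has_field_derivative_iff)
    show "((\<lambda>y. (v y - v 0) / (y - 0)) \<longlongrightarrow> 0) (at 0 within {0..})"
      using v0(1) by (simp add: has_field_derivative_iff)
    show "at (0::real) within {0..} \<noteq> bot"
      by (simp add: at_within_Ici_at_right)
  qed
  have v_cont: "continuous_on {0..} v"
    using v1 by (auto simp: continuous_on_eq_continuous_within intro: DERIV_continuous)
  define w where "w r = v r powr m" for r
  define w1 where "w1 r = m * v r powr (m - 1) * v1 r" for r
  define w2 where "w2 = deriv w1"
  have w_cont: "continuous_on {0..} w"
    unfolding w_def using vpos by (intro continuous_intros v_cont) (auto simp: less_imp_neq[symmetric])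
  have w1_cont: "continuous_on {0..} w1"
    unfolding w1_def using vpos
    by (intro continuous_intros v_cont v1_cont) (auto simp: less_imp_neq[symmetric])
  have w_deriv: "(w has_real_derivative w1 r) (at r)" if "r > 0" for r
    unfolding w_def w1_def
    using DERIV_fun_powr[OF v1_at[OF that] vpos', OF that, of m] by simp
  have dw: "deriv w r = w1 r" if "r > 0" for r using w_deriv[OF that] by (rule DERIV_imp_deriv)
  have v1_diff: "v1 differentiable (at r)" if "r > 0" for r
  proof -
    have "deriv v differentiable (at r)"
      using C2 that unfolding C2_on_pos_def
      by (meson C1_differentiable_on_eq greaterThan_iff)
    then obtain D where "(deriv v has_real_derivative D) (at r)"
      using real_differentiable_def by blast
    then have "(v1 has_real_derivative D) (at r)"
      by (rule has_field_derivative_transform_within_open[of _ _ _ "{0<..}"])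
        (use that dv in auto)
    then show ?thesis using real_differentiable_def by blast
  qed
  have w1_deriv: "(w1 has_real_derivative w2 r) (at r)" if r: "r > 0" for r
  proof -
    obtain D where D: "(v1 has_real_derivative D) (at r)"
      using v1_diff[OF r] real_differentiable_def by blast
    have "\<exists>y. (w1 has_real_derivative y) (at r)"
      unfolding w1_def
      using DERIV_mult[OF DERIV_cmult[OF DERIV_fun_powr[OF v1_at[OF r] vpos'[OF r], of "m - 1"], of m] D]
      by blast
    then show ?thesis unfolding w2_def using DERIV_imp_deriv by blast
  qed
  \<comment> \<open>The functions \<open>deriv w\<close> and \<open>w1\<close> are known to agree on
    the open half-line, which suffices to transfer the derivative.\<close>
  have ddw: "deriv (deriv w) r = w2 r" if r: "r > 0" for r
  proof (rule DERIV_imp_deriv)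
    show "(deriv w has_real_derivative w2 r) (at r)"
      by (rule has_field_derivative_transform_within_open[OF w1_deriv[OF r], of "{0<..}"])
        (use r dw in auto)
  qed
  define N where "N = n - 1"
  have N: "N \<ge> 1" "real N = real n - 1" using assms(1) by (auto simp: N_def)
  define c where "c = real N / m"
  have "c > 0" using N \<open>0 < m\<close> by (simp add: c_def)
  have eq: "w2 r + real N / r * w1 r = (- \<alpha> * v r - \<beta> * r * v1 r) / c" if r: "r > 0" for r
  proof -
    have "c * (w2 r + real N / r * w1 r) + \<alpha> * v r + \<beta> * r * v1 r = 0"
      using ode[OF r] unfolding radial_ode_def w_def[symmetric] ddw[OF r] dw[OF r] dv[OF r]
        N(2)[symmetric] c_def[symmetric] .
    then show ?thesis using \<open>c > 0\<close> by (simp add: field_simps)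
  qed
  have w1_pos_if: "w1 r > 0"
    if r: "r > 0" and rhs: "\<And>x. 0 < x \<Longrightarrow> x < r \<Longrightarrow> - \<alpha> * v x - \<beta> * x * v1 x > 0" for r
  proof (rule radial_flux_increasing[OF N(1) r])
    show "continuous_on {0..r} w1" by (rule continuous_on_subset[OF w1_cont]) auto
    show "(w1 has_real_derivative w2 x) (at x)" if "0 < x" for x using w1_deriv that .
    show "w2 x + real N / x * w1 x > 0" if "0 < x" "x < r" for x
      using eq[of x] rhs[of x] that \<open>c > 0\<close> by simp
  qed
  have v1_w1: "v1 r > 0 \<longleftrightarrow> w1 r > 0" if "r > 0" for r
  proof -
    have "m * v r powr (m - 1) > 0" using vpos'[OF that] \<open>0 < m\<close> by simp
    then show ?thesis using zero_less_mult_pos mult_pos_pos unfolding w1_def by blast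
  qed
  \<comment> \<open>Up to the factor \<open>c\<close>, this is the right-hand side of
    \<open>eq\<close>. Continuation is run on \<open>g\<close> rather than on \<open>v1\<close>,
    because \<open>v1\<close> vanishes at 0 whereas \<open>g 0 = - \<alpha> * \<eta>\<close> is
    positive.\<close>
  define g where "g r = - \<alpha> * v r - \<beta> * r * v1 r" for r
  have g_pos: "g b > 0" if "b \<ge> 0" for b
  proof (rule continuation_pos[OF that])
    show "continuous_on {0..b} g"
      unfolding g_def
      by (intro continuous_intros continuous_on_subset[OF v_cont] continuous_on_subset[OF v1_cont]) auto
    show "g 0 > 0" using \<open>\<alpha> < 0\<close> vpos[of 0] by (simp add: g_def mult_neg_pos)
    fix r assume r: "0 < r" and "\<And>x. 0 \<le> x \<Longrightarrow> x < r \<Longrightarrow> g x > 0"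
    then have "v1 r > 0" using v1_w1 w1_pos_if by (simp add: g_def)
    then have "- \<beta> * r * v1 r \<ge> 0" using r \<open>\<beta> \<le> 0\<close> by (intro mult_nonneg_nonneg) auto
    moreover have "- \<alpha> * v r > 0" using \<open>\<alpha> < 0\<close> vpos'[OF r] by (intro mult_pos_pos) auto
    ultimately show "g r > 0" by (simp add: g_def)
  qed
  have v1_pos: "v1 r > 0" if "r > 0" for r
    using v1_w1[OF that] w1_pos_if[OF that] g_pos by (simp add: g_def)
  show False
  proof (rule keller_osserman_radial[OF N(1) _ _ _ w_cont w1_cont w_deriv w1_deriv])
    show "- \<alpha> / c > 0" using \<open>\<alpha> < 0\<close> \<open>c > 0\<close> by (intro divide_pos_pos) auto
    show "1 / m > 1" using \<open>0 < m\<close> \<open>m < 1\<close> by simp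
    show "w 0 > 0" using vpos[of 0] by (simp add: w_def)
    \<comment> \<open>Since \<open>w r powr (1 / m) = v r\<close>, this is \<open>eq\<close> with
      the nonnegative drift term dropped.\<close>
    show "- \<alpha> / c * w r powr (1 / m) \<le> w2 r + real N / r * w1 r" if r: "r > 0" for r
    proof -
      have "w r powr (1 / m) = v r" using vpos'[OF r] \<open>0 < m\<close> by (simp add: w_def powr_powr)
      moreover have "- \<beta> * r * v1 r \<ge> 0"
        using r \<open>\<beta> \<le> 0\<close> v1_pos[OF r] by (intro mult_nonneg_nonneg) auto
      ultimately show ?thesis
        using eq[OF r] divide_right_mono[of "- \<alpha> * v r" "- \<alpha> * v r - \<beta> * r * v1 r" c] \<open>c > 0\<close>
        by simp
    qed
  qed
qed

end
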